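(* Let $0<\alpha\le 1$ and $0\le\beta<1$ with $(\alpha,\beta)\ne(1,0)$, and let $\gamma=\frac{\beta}{1+\beta-\alpha}$. Let $s_0,s_1,s_2,\dots$ be a $\{0,1\}$-valued Markov chain with $\Pr[s_0=1]=\gamma$, $\Pr[s_i=1\mid s_{i-1}=1]=\alpha$ and $\Pr[s_i=1\mid s_{i-1}=0]=\beta$ for all $i\ge 1$, and for $n\ge 1$ let $S_n=s_1s_2\cdots s_n$ (the letter $s_0$ is not part of the string). Put $$M=\begin{bmatrix}\alpha&0&\alpha&0\\ 1-\alpha&\alpha&1-\alpha&\frac{\beta(1-\alpha)}{1-\beta}\\ \frac{(1-\alpha)\beta}{\alpha}&\beta&1-\beta&\beta\\ 0&1-\beta&0&1-\beta\end{bmatrix},\qquad v=\begin{bmatrix}\gamma\alpha\\ \gamma(1-\alpha)\\ (1-\gamma)\beta\\ (1-\gamma)(1-\beta)\end{bmatrix}.$$ Then for every $n\ge 1$, $$E[\phi(S_n)]=\begin{bmatrix}1&1&1&1\end{bmatrix}\left(\sum_{i=0}^{n-1}M^{i}\right)v,$$ where $M^0$ is the identity matrix.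
   Context: A string $B$ of length $m$ with $1\le m\le n$ is a subsequence of a string $A=a_1a_2\cdots a_n$ if there are indices $i_1<i_2<\dots<i_m$ with $B=a_{i_1}a_{i_2}\cdots a_{i_m}$. For a string $T$, $\phi(T)$ denotes the number of distinct strings that are subsequences of $T$; the empty string is not counted as a subsequence. *)

theory Defs
  imports "HOL-Probability.Probability" "HOL-Library.Sublist"
begin

definition num_subseqs :: "'a list \<Rightarrow> nat" where
  "num_subseqs T = card {B. B \<noteq> [] \<and> subseq B T}"

(* Conditional probabilities are constrained only when the conditioning event has positive
   probability: cond_prob is 0 on null events, and an unguarded equation would then be a
   spurious requirement (this matters, e.g., if some state has probability 0). *)
definition markov_chain :: "'w measure \<Rightarrow> 'a set \<Rightarrow> (nat \<Rightarrow> 'w \<Rightarrow> 'a) \<Rightarrow> bool" where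
  "markov_chain P A X \<longleftrightarrow>
     prob_space P \<and> countable A \<and>
     (\<forall>n. X n \<in> measurable P (count_space A)) \<and>
     (\<forall>n x. \<P>(\<omega> in P. \<forall>i\<le>n. X i \<omega> = x i) > 0 \<longrightarrow>
        \<P>(\<omega> in P. X (Suc n) \<omega> = x (Suc n) \<bar> \<forall>i\<le>n. X i \<omega> = x i) =
        \<P>(\<omega> in P. X (Suc n) \<omega> = x (Suc n) \<bar> X n \<omega> = x n))"

(* The power operation on the type real^'n^'n is componentwise, so the matrix power is
   defined here. *)
primrec mat_power :: "real^'n^'n \<Rightarrow> nat \<Rightarrow> real^'n^'n" where
  "mat_power M 0 = mat 1"
| "mat_power M (Suc k) = M ** mat_power M k"

end

theory Submission
  imports Defs
begin

text \<open>
  The idea is to count subsequences by their last letter. Let \<open>N c T\<close> be the number of distinct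
  subsequences of \<open>T\<close> that end in \<open>c\<close> (\<open>count_ending\<close>). Appending a letter \<open>b\<close> leaves \<open>N c\<close>
  unchanged for \<open>c \<noteq> b\<close>, while afterwards every old subsequence, the empty one included, can be
  prolonged by the final \<open>b\<close>, so \<open>N b (T b) = 1 + \<phi>(T)\<close>. For binary strings
  \<open>\<phi>(T) = N 0 T + N 1 T\<close>, so appending \<open>b\<close> creates exactly \<open>1 + N (1 - b) T\<close> new subsequences, and the
  two quantities \<open>1 + N 0 T\<close> and \<open>1 + N 1 T\<close> evolve linearly and homogeneously.

  Put \<open>u n a c = E[1 + N c S\<^sub>n; s\<^sub>n = a]\<close> (\<open>ending_weight\<close>) and let \<open>q a b\<close> be the transition
  probabilities. Conditioning on the history up to time \<open>n\<close> (\<open>expectation_hist_Suc\<close>, \<open>on_last_Suc\<close>)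
  turns the recursion for strings into a linear recursion for these four numbers
  (\<open>ending_weight_Suc_other\<close>, \<open>ending_weight_Suc_same\<close>), started at \<open>u 0 a c = Pr[s\<^sub>0 = a]\<close>. The expected
  number of subsequences that are created by step \<open>n + 1\<close> on the event \<open>s\<^sub>n = a, s\<^sub>n\<^sub>+\<^sub>1 = b\<close> is
  \<open>q a b * u n a (1 - b)\<close>. The vector \<open>w\<^sub>n\<close> of these, for \<open>(a, b)\<close> = \<open>(1,1)\<close>, \<open>(1,0)\<close>, \<open>(0,1)\<close>, \<open>(0,0)\<close>, is
  \<open>v\<close> for \<open>n = 0\<close>, and the recursion for \<open>u\<close> says precisely \<open>w\<^sub>n\<^sub>+\<^sub>1 = M w\<^sub>n\<close>: the quotients in \<open>M\<close>
  recover \<open>u n 1 0\<close> and \<open>u n 0 1\<close> from \<open>\<alpha> * u n 1 0\<close> and \<open>(1 - \<beta>) * u n 0 1\<close>, which is possible since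
  \<open>\<alpha> \<noteq> 0\<close> and \<open>\<beta> \<noteq> 1\<close>. Summing the entries of \<open>w\<^sub>0, \<dots>, w\<^sub>n\<^sub>-\<^sub>1\<close> gives \<open>E[\<phi>(S\<^sub>n)]\<close>.
\<close>

section \<open>Counting subsequences by their last letter\<close>

definition count_ending :: "'a \<Rightarrow> 'a list \<Rightarrow> nat" where
  "count_ending c T = card {B. subseq (B @ [c]) T}"

lemma finite_subseqs: "finite {B. subseq B T}"
  unfolding set_subseqs_eq[symmetric] by simp

lemma finite_ending: "finite {B. subseq (B @ [c]) T}"
  using finite_vimageI[OF finite_subseqs, of "\<lambda>B. B @ [c]" T]
  by (simp add: inj_on_def vimage_def)

lemma count_ending_Nil [simp]: "count_ending c [] = 0"
  by (simp add: count_ending_def)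

text \<open>
  A subsequence ending in \<open>c\<close> can always use the final \<open>c\<close>, so what precedes it is an arbitrary
  subsequence of \<open>T\<close>; the successor accounts for the empty one.
\<close>

lemma count_ending_snoc_same: "count_ending c (T @ [c]) = Suc (num_subseqs T)"
proof -
  have "{B. subseq (B @ [c]) (T @ [c])} = insert [] {B. B \<noteq> [] \<and> subseq B T}"
    by auto
  moreover have "finite {B. B \<noteq> [] \<and> subseq B T}"
    by (rule finite_subset[OF _ finite_subseqs[of T]]) auto
  ultimately show ?thesis
    by (simp add: count_ending_def num_subseqs_def)
qed

lemma count_ending_snoc_other:
  assumes "c \<noteq> d"
  shows "count_ending c (T @ [d]) = count_ending c T"
proof -
  have "subseq (B @ [c]) (T @ [d]) \<longleftrightarrow> subseq (B @ [c]) T" for B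
  proof
    assume "subseq (B @ [c]) (T @ [d])"
    then obtain B1 B2 where B: "B @ [c] = B1 @ B2" "subseq B1 T" "subseq B2 [d]"
      by (rule subseq_appendE)
    have "B2 = []"
    proof (rule ccontr)
      assume "B2 \<noteq> []"
      with B(1) have "c \<in> set B2" by (metis last_appendR last_in_set last_snoc)
      then obtain b where "b \<in> set [d]" "c = b" by (rule list_emb_set[OF B(3)])
      with assms show False by simp
    qed
    with B show "subseq (B @ [c]) T" by simp
  qed (rule subseq_rev_drop_many)
  then show ?thesis
    by (simp add: count_ending_def)
qed

lemma num_subseqs_eq_sum_count_ending:
  assumes "finite A" "set T \<subseteq> A"
  shows "num_subseqs T = (\<Sum>c\<in>A. count_ending c T)"
proof -
  let ?S = "SIGMA c:A. {B. subseq (B @ [c]) T}"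
  have "{B. B \<noteq> [] \<and> subseq B T} = (\<lambda>(c, B). B @ [c]) ` ?S" (is "?L = ?R")
  proof
    show "?L \<subseteq> ?R"
    proof
      fix B assume B: "B \<in> ?L"
      then have eq: "B = butlast B @ [last B]" by simp
      have "last B \<in> A"
      proof -
        have "subseq B T" "last B \<in> set B" using B by simp_all
        then obtain b where "b \<in> set T" "last B = b" by (rule list_emb_set)
        with assms(2) show ?thesis by auto
      qed
      with B eq have "(last B, butlast B) \<in> ?S" by simp
      with eq show "B \<in> ?R" by force
    qed
  qed auto
  moreover have "inj_on (\<lambda>(c, B). B @ [c]) ?S"
    by (auto simp: inj_on_def)
  ultimately have "num_subseqs T = card ?S"
    by (simp add: num_subseqs_def card_image)
  also have "\<dots> = (\<Sum>c\<in>A. count_ending c T)"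
    using assms(1) by (simp add: card_SigmaI finite_ending count_ending_def)
  finally show ?thesis .
qed

section \<open>Finite Markov chains\<close>

lemma markov_chain_event:
  assumes "markov_chain P A X"
  shows "{\<omega> \<in> space P. X n \<omega> = x} \<in> sets P"
proof -
  have X: "X n \<in> measurable P (count_space A)"
    using assms by (simp add: markov_chain_def)
  have "{\<omega> \<in> space P. X n \<omega> = x} = X n -` ({x} \<inter> A) \<inter> space P"
    using measurable_space[OF X] by auto
  also have "\<dots> \<in> sets P"
    by (rule measurable_sets[OF X]) auto
  finally show ?thesis .
qed

text \<open>
  The transition kernel \<open>q\<close> is tied to the chain by joint instead of conditional probabilities, so that
  the equation holds also for states of probability 0, whatever \<open>q\<close> is there.
\<close>

locale finite_chain =
  fixes P :: "'w measure" and A :: "'a set" and X :: "nat \<Rightarrow> 'w \<Rightarrow> 'a"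
    and q :: "'a \<Rightarrow> 'a \<Rightarrow> real"
  assumes chain: "markov_chain P A X"
    and fin: "finite A"
    and trans: "\<And>n x y. x \<in> A \<Longrightarrow> y \<in> A \<Longrightarrow>
      \<P>(\<omega> in P. X (Suc n) \<omega> = y \<and> X n \<omega> = x) = q x y * \<P>(\<omega> in P. X n \<omega> = x)"
begin

sublocale prob_space P
  using chain by (simp add: markov_chain_def)

definition hist :: "nat \<Rightarrow> 'w \<Rightarrow> 'a list" where
  "hist n \<omega> = map (\<lambda>i. X i \<omega>) [0..<Suc n]"

definition paths :: "nat \<Rightarrow> 'a list set" where
  "paths n = {xs. set xs \<subseteq> A \<and> length xs = Suc n}"

lemma measurable_X [measurable]: "X n \<in> measurable P (count_space A)"
  using chain by (simp add: markov_chain_def)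

lemma hist_Suc: "hist (Suc n) \<omega> = hist n \<omega> @ [X (Suc n) \<omega>]"
  by (simp add: hist_def)

lemma last_hist [simp]: "last (hist n \<omega>) = X n \<omega>"
  by (simp add: hist_def)

lemma hist_eq_iff:
  assumes "length xs = Suc n"
  shows "hist n \<omega> = xs \<longleftrightarrow> (\<forall>i\<le>n. X i \<omega> = xs ! i)"
  using assms by (auto simp: hist_def list_eq_iff_nth_eq less_Suc_eq_le simp del: upt_Suc)

lemma hist_in_paths:
  assumes "\<omega> \<in> space P"
  shows "hist n \<omega> \<in> paths n"
  using measurable_space[OF measurable_X assms] by (auto simp: hist_def paths_def)

lemma finite_paths: "finite (paths n)"
  unfolding paths_def using fin by (rule finite_lists_length_eq)

lemma paths_Suc: "paths (Suc n) = (\<lambda>(xs, y). xs @ [y]) ` (paths n \<times> A)"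
proof
  show "paths (Suc n) \<subseteq> (\<lambda>(xs, y). xs @ [y]) ` (paths n \<times> A)"
  proof
    fix zs assume zs: "zs \<in> paths (Suc n)"
    then have "zs \<noteq> []" by (auto simp: paths_def)
    then obtain xs y where "zs = xs @ [y]" by (metis append_butlast_last_id)
    with zs show "zs \<in> (\<lambda>(xs, y). xs @ [y]) ` (paths n \<times> A)"
      by (auto simp: paths_def)
  qed
qed (auto simp: paths_def)

lemma single_event [measurable]: "{\<omega> \<in> space P. X n \<omega> = x} \<in> events"
  using chain by (rule markov_chain_event)

lemma hist_event:
  assumes "xs \<in> paths n"
  shows "{\<omega> \<in> space P. hist n \<omega> = xs} \<in> events"
proof -
  have len: "length xs = Suc n" using assms by (simp add: paths_def)
  have "{\<omega> \<in> space P. \<forall>i\<in>{..n}. X i \<omega> = xs ! i} \<in> events"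
    by (intro sets.sets_Collect_finite_All single_event) auto
  then show ?thesis
    by (simp add: hist_eq_iff[OF len] Ball_def)
qed

text \<open>
  The Markov property is only available on histories of positive probability; on the others both sides
  vanish by monotonicity.
\<close>

lemma prob_hist_Suc:
  assumes xs: "xs \<in> paths n" and y: "y \<in> A"
  shows "\<P>(\<omega> in P. hist (Suc n) \<omega> = xs @ [y]) = q (last xs) y * \<P>(\<omega> in P. hist n \<omega> = xs)"
proof -
  let ?z = "(!) (xs @ [y])"
  have len: "length xs = Suc n" and "last xs \<in> A"
    using xs last_in_set[of xs] by (cases xs; auto simp: paths_def)+
  have z: "?z n = last xs" "?z (Suc n) = y" and zi: "\<And>i. i \<le> n \<Longrightarrow> ?z i = xs ! i"
    using len by (cases "xs = []"; simp add: nth_append last_conv_nth)+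
  have hist_iff: "hist n \<omega> = xs \<longleftrightarrow> (\<forall>i\<le>n. X i \<omega> = ?z i)" for \<omega>
    by (simp add: hist_eq_iff[OF len] zi)
  have hist_Suc_iff: "hist (Suc n) \<omega> = xs @ [y] \<longleftrightarrow> X (Suc n) \<omega> = y \<and> hist n \<omega> = xs" for \<omega>
    by (auto simp: hist_Suc)
  have sub: "\<P>(\<omega> in P. hist n \<omega> = xs) \<le> \<P>(\<omega> in P. X n \<omega> = last xs)"
    by (rule finite_measure_mono[OF _ single_event]) (auto simp flip: last_hist)
  show ?thesis
  proof (cases "\<P>(\<omega> in P. hist n \<omega> = xs) = 0")
    case True
    have "\<P>(\<omega> in P. hist (Suc n) \<omega> = xs @ [y]) \<le> \<P>(\<omega> in P. hist n \<omega> = xs)"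
      by (rule finite_measure_mono) (auto simp: hist_Suc_iff hist_event[OF xs])
    with True show ?thesis by (simp add: measure_le_0_iff)
  next
    case False
    then have pos: "\<P>(\<omega> in P. hist n \<omega> = xs) > 0"
      by (simp add: zero_less_measure_iff)
    then have "\<P>(\<omega> in P. X (Suc n) \<omega> = ?z (Suc n) \<bar> \<forall>i\<le>n. X i \<omega> = ?z i) =
        \<P>(\<omega> in P. X (Suc n) \<omega> = ?z (Suc n) \<bar> X n \<omega> = ?z n)"
      using chain unfolding markov_chain_def hist_iff by blast
    then have "\<P>(\<omega> in P. X (Suc n) \<omega> = y \<bar> hist n \<omega> = xs) =
        \<P>(\<omega> in P. X (Suc n) \<omega> = y \<bar> X n \<omega> = last xs)"
      unfolding z hist_iff[symmetric] .
    then have "\<P>(\<omega> in P. X (Suc n) \<omega> = y \<bar> hist n \<omega> = xs) = q (last xs) y"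
      using pos sub trans[OF \<open>last xs \<in> A\<close> y] by (simp add: cond_prob_def)
    then show ?thesis
      using pos by (simp add: cond_prob_def hist_Suc_iff field_simps)
  qed
qed

text \<open>
  Only finitely many histories of a given length are possible, so a function of the history is a simple
  function, and its expectation is a finite sum.
\<close>

lemma hist_expansion:
  fixes g :: "'a list \<Rightarrow> real"
  assumes "\<omega> \<in> space P"
  shows "g (hist n \<omega>) = (\<Sum>xs\<in>paths n. g xs * indicator {\<omega> \<in> space P. hist n \<omega> = xs} \<omega>)"
proof -
  have "(\<Sum>xs\<in>paths n. g xs * indicator {\<omega> \<in> space P. hist n \<omega> = xs} \<omega>)
    = (\<Sum>xs\<in>paths n. if xs = hist n \<omega> then g xs else 0)"
    using assms by (intro sum.cong) (auto simp: indicator_def)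
  also have "\<dots> = g (hist n \<omega>)"
    using finite_paths hist_in_paths[OF assms] by simp
  finally show ?thesis by simp
qed

lemma
  fixes g :: "'a list \<Rightarrow> real"
  shows integrable_hist: "integrable P (\<lambda>\<omega>. g (hist n \<omega>))"
    and expectation_hist:
      "expectation (\<lambda>\<omega>. g (hist n \<omega>)) = (\<Sum>xs\<in>paths n. g xs * \<P>(\<omega> in P. hist n \<omega> = xs))"
proof -
  let ?f = "\<lambda>\<omega>. \<Sum>xs\<in>paths n. g xs * indicator {\<omega> \<in> space P. hist n \<omega> = xs} \<omega>"
  have int: "integrable P (\<lambda>\<omega>. g xs * indicator {\<omega> \<in> space P. hist n \<omega> = xs} \<omega>)"
    if "xs \<in> paths n" for xs
    using hist_event[OF that] by (intro integrable_mult_right integrable_real_indicator) (auto simp: less_top[symmetric])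
  have "integrable P ?f"
    using int by (intro Bochner_Integration.integrable_sum)
  then show "integrable P (\<lambda>\<omega>. g (hist n \<omega>))"
    by (subst Bochner_Integration.integrable_cong[OF refl hist_expansion])
  have "expectation (\<lambda>\<omega>. g (hist n \<omega>)) = expectation ?f"
    by (intro Bochner_Integration.integral_cong refl hist_expansion)
  also have "\<dots> = (\<Sum>xs\<in>paths n. g xs * \<P>(\<omega> in P. hist n \<omega> = xs))"
    using hist_event by (subst Bochner_Integration.integral_sum[OF int]) (auto intro!: sum.cong)
  finally show "expectation (\<lambda>\<omega>. g (hist n \<omega>)) = (\<Sum>xs\<in>paths n. g xs * \<P>(\<omega> in P. hist n \<omega> = xs))" .
qed

text \<open>
  This is the tower rule: the right-hand side averages the conditional expectation given the history up
  to time \<open>n\<close>.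
\<close>

lemma expectation_hist_Suc:
  fixes g :: "'a list \<Rightarrow> real"
  shows "expectation (\<lambda>\<omega>. g (hist (Suc n) \<omega>)) =
    expectation (\<lambda>\<omega>. \<Sum>y\<in>A. q (X n \<omega>) y * g (hist n \<omega> @ [y]))"
proof -
  have inj: "inj_on (\<lambda>(xs, y). xs @ [y]) (paths n \<times> A)"
    by (auto simp: inj_on_def)
  have "expectation (\<lambda>\<omega>. g (hist (Suc n) \<omega>))
      = (\<Sum>(xs, y)\<in>paths n \<times> A. g (xs @ [y]) * \<P>(\<omega> in P. hist (Suc n) \<omega> = xs @ [y]))"
    unfolding expectation_hist paths_Suc by (subst sum.reindex[OF inj]) (simp add: case_prod_beta)
  also have "\<dots> = (\<Sum>xs\<in>paths n. (\<Sum>y\<in>A. q (last xs) y * g (xs @ [y])) * \<P>(\<omega> in P. hist n \<omega> = xs))"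
    unfolding sum.cartesian_product[symmetric] sum_distrib_right
    by (intro sum.cong refl) (simp add: prob_hist_Suc)
  also have "\<dots> = expectation (\<lambda>\<omega>. (\<lambda>xs. \<Sum>y\<in>A. q (last xs) y * g (xs @ [y])) (hist n \<omega>))"
    by (rule expectation_hist[symmetric])
  finally show ?thesis by simp
qed


text \<open>
  The string under study starts with the letter at time 1, whereas the chain and its history start at
  time 0; hence the \<open>tl\<close>. The event \<open>X n = a\<close> is kept because a string of length 0 does not determine
  the current state.
\<close>

definition on_last :: "nat \<Rightarrow> 'a \<Rightarrow> ('a list \<Rightarrow> real) \<Rightarrow> real" where
  "on_last n a f = expectation (\<lambda>\<omega>. of_bool (X n \<omega> = a) * f (tl (hist n \<omega>)))"

lemma set_tl_hist:
  assumes "\<omega> \<in> space P"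
  shows "set (tl (hist n \<omega>)) \<subseteq> A"
  using hist_in_paths[OF assms, of n] by (cases "hist n \<omega>") (auto simp: paths_def)

lemma integrable_on_last: "integrable P (\<lambda>\<omega>. of_bool (X n \<omega> = a) * f (tl (hist n \<omega>)))"
  for f :: "'a list \<Rightarrow> real"
  using integrable_hist[of "\<lambda>xs. of_bool (last xs = a) * f (tl xs)" n] by simp

lemma on_last_cong:
  assumes "\<And>T. set T \<subseteq> A \<Longrightarrow> f T = g T"
  shows "on_last n a f = on_last n a g"
  unfolding on_last_def
  by (intro Bochner_Integration.integral_cong refl) (simp add: assms[OF set_tl_hist])

lemma on_last_add: "on_last n a (\<lambda>T. f T + g T) = on_last n a f + on_last n a g"
  unfolding on_last_def distrib_left
  by (intro Bochner_Integration.integral_add integrable_on_last)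

lemma expand_last:
  fixes g :: "'a \<Rightarrow> real"
  assumes "\<omega> \<in> space P"
  shows "(\<Sum>a\<in>A. of_bool (X n \<omega> = a) * g a) = g (X n \<omega>)"
proof -
  have "X n \<omega> \<in> A"
    using measurable_space[OF measurable_X assms] by simp
  moreover have "of_bool (X n \<omega> = a) * g a = (if X n \<omega> = a then g a else 0)" for a
    by simp
  ultimately show ?thesis using fin by (simp only: sum.delta' if_True)
qed

lemma expectation_tl_hist:
  "expectation (\<lambda>\<omega>. f (tl (hist n \<omega>))) = (\<Sum>a\<in>A. on_last n a f)"
proof -
  have "expectation (\<lambda>\<omega>. f (tl (hist n \<omega>)))
      = expectation (\<lambda>\<omega>. \<Sum>a\<in>A. of_bool (X n \<omega> = a) * f (tl (hist n \<omega>)))"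
    by (intro Bochner_Integration.integral_cong refl) (rule expand_last[symmetric])
  also have "\<dots> = (\<Sum>a\<in>A. on_last n a f)"
    unfolding on_last_def by (intro Bochner_Integration.integral_sum integrable_on_last)
  finally show ?thesis .
qed

lemma on_last_0: "on_last 0 a f = f [] * \<P>(\<omega> in P. X 0 \<omega> = a)"
proof -
  have "on_last 0 a f = expectation (\<lambda>\<omega>. f [] * indicator {\<omega> \<in> space P. X 0 \<omega> = a} \<omega>)"
    unfolding on_last_def
    by (intro Bochner_Integration.integral_cong) (auto simp: hist_def indicator_def)
  then show ?thesis by simp
qed

lemma on_last_Suc:
  assumes "b \<in> A"
  shows "on_last (Suc n) b f = (\<Sum>a\<in>A. q a b * on_last n a (\<lambda>T. f (T @ [b])))"
proof -
  have tl_snoc: "tl (hist n \<omega> @ [y]) = tl (hist n \<omega>) @ [y]" for \<omega> y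
    by (simp add: hist_def del: upt_Suc)
  have "on_last (Suc n) b f
      = expectation (\<lambda>\<omega>. \<Sum>y\<in>A. q (X n \<omega>) y * (of_bool (y = b) * f (tl (hist n \<omega>) @ [y])))"
    using expectation_hist_Suc[of "\<lambda>xs. of_bool (last xs = b) * f (tl xs)" n]
    by (simp add: on_last_def tl_snoc)
  also have "\<dots> = expectation (\<lambda>\<omega>. q (X n \<omega>) b * f (tl (hist n \<omega>) @ [b]))"
  proof -
    have "x * (of_bool (y = b) * z) = (if y = b then x * z else 0)" for x z :: real and y
      by simp
    then show ?thesis
      using fin assms by (simp only: sum.delta if_True)
  qed
  also have "\<dots> = expectation (\<lambda>\<omega>. \<Sum>a\<in>A. q a b * (of_bool (X n \<omega> = a) * f (tl (hist n \<omega>) @ [b])))"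
  proof (intro Bochner_Integration.integral_cong refl)
    fix \<omega> assume "\<omega> \<in> space P"
    from expand_last[OF this, of n "\<lambda>a. q a b * f (tl (hist n \<omega>) @ [b])"]
    show "q (X n \<omega>) b * f (tl (hist n \<omega>) @ [b])
        = (\<Sum>a\<in>A. q a b * (of_bool (X n \<omega> = a) * f (tl (hist n \<omega>) @ [b])))"
      by (simp add: mult_ac)
  qed
  also have "\<dots> = (\<Sum>a\<in>A. q a b * on_last n a (\<lambda>T. f (T @ [b])))"
    unfolding on_last_def
    by (subst Bochner_Integration.integral_sum)
       (auto intro!: integrable_mult_right integrable_on_last[where f = "\<lambda>T. f (T @ [b])"])
  finally show ?thesis .
qed

end

section \<open>Binary chains\<close>

lemma binary_num_subseqs:
  fixes T :: "nat list"
  assumes "set T \<subseteq> {0, 1}"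
  shows "num_subseqs T = count_ending 0 T + count_ending 1 T"
  using num_subseqs_eq_sum_count_ending[OF _ assms] by simp

locale binary_chain = finite_chain P "{0, 1 :: nat}" X q for P X q
begin

text \<open>
  The summand 1 stands for the empty string; it makes the recursion homogeneous.
\<close>

definition ending_weight :: "nat \<Rightarrow> nat \<Rightarrow> nat \<Rightarrow> real" where
  "ending_weight n a c = on_last n a (\<lambda>T. 1 + real (count_ending c T))"

lemma ending_weight_0: "ending_weight 0 a c = \<P>(\<omega> in P. X 0 \<omega> = a)"
  by (simp add: ending_weight_def on_last_0)

lemma ending_weight_Suc_other:
  assumes "b \<in> {0, 1}" "c \<noteq> b"
  shows "ending_weight (Suc n) b c = q 0 b * ending_weight n 0 c + q 1 b * ending_weight n 1 c"
  unfolding ending_weight_def on_last_Suc[OF assms(1)]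
  by (simp add: count_ending_snoc_other[OF assms(2)])

lemma on_last_total:
  "on_last n a (\<lambda>T. 2 + real (num_subseqs T)) = ending_weight n a 0 + ending_weight n a 1"
  unfolding ending_weight_def on_last_add[symmetric]
  by (rule on_last_cong) (simp add: binary_num_subseqs)

lemma ending_weight_Suc_same:
  assumes "b \<in> {0, 1}"
  shows "ending_weight (Suc n) b b
    = q 0 b * (ending_weight n 0 0 + ending_weight n 0 1)
    + q 1 b * (ending_weight n 1 0 + ending_weight n 1 1)"
proof -
  have "1 + real (count_ending b (T @ [b])) = 2 + real (num_subseqs T)" for T
    by (simp add: count_ending_snoc_same)
  then show ?thesis
    unfolding ending_weight_def[of "Suc n"] on_last_Suc[OF assms]
    by (simp add: on_last_total)
qed

lemma expectation_num_subseqs: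
  "expectation (\<lambda>\<omega>. real (num_subseqs (tl (hist n \<omega>)))) =
    ending_weight n 0 0 + ending_weight n 0 1 + ending_weight n 1 0 + ending_weight n 1 1 - 2"
proof -
  have "expectation (\<lambda>\<omega>. 2 + real (num_subseqs (tl (hist n \<omega>))))
      = 2 + expectation (\<lambda>\<omega>. real (num_subseqs (tl (hist n \<omega>))))"
    using integrable_hist[of "\<lambda>xs. real (num_subseqs (tl xs))" n]
    by (simp add: prob_space)
  then show ?thesis
    using expectation_tl_hist[of "\<lambda>T. 2 + real (num_subseqs T)" n]
    by (simp add: on_last_total)
qed

end

section \<open>The matrix formula\<close>

lemma vector_4 [simp]:
  "(vector [x, y, z, w] :: 'a::zero^4) $ 1 = x"
  "(vector [x, y, z, w] :: 'a::zero^4) $ 2 = y"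
  "(vector [x, y, z, w] :: 'a::zero^4) $ 3 = z"
  "(vector [x, y, z, w] :: 'a::zero^4) $ 4 = w"
  by (simp_all add: vector_def)

lemma sum_matrix_vector_mult: "sum F I *v x = (\<Sum>i\<in>I. F i *v x)"
  for F :: "'i \<Rightarrow> real^'n^'m"
  by (induction I rule: infinite_finite_induct) (auto simp: matrix_vector_mult_add_rdistrib)

theorem mainTheorem4:
  fixes P :: "'w measure" and s :: "nat \<Rightarrow> 'w \<Rightarrow> nat"
    and \<alpha> \<beta> \<gamma> :: real and M :: "real^4^4" and v :: "real^4" and n :: nat
  assumes "0 < \<alpha>" "\<alpha> \<le> 1" "0 \<le> \<beta>" "\<beta> < 1" "(\<alpha>, \<beta>) \<noteq> (1, 0)"
    and "\<gamma> = \<beta> / (1 + \<beta> - \<alpha>)"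
    and "markov_chain P {0, 1} s"
    and "\<P>(\<omega> in P. s 0 \<omega> = 1) = \<gamma>"
    and "\<And>i. i \<ge> 1 \<Longrightarrow> \<P>(\<omega> in P. s (i - 1) \<omega> = 1) > 0 \<Longrightarrow>
           \<P>(\<omega> in P. s i \<omega> = 1 \<bar> s (i - 1) \<omega> = 1) = \<alpha>"
    and "\<And>i. i \<ge> 1 \<Longrightarrow> \<P>(\<omega> in P. s (i - 1) \<omega> = 0) > 0 \<Longrightarrow>
           \<P>(\<omega> in P. s i \<omega> = 1 \<bar> s (i - 1) \<omega> = 0) = \<beta>"
    and "M = vector
      [vector [\<alpha>, 0, \<alpha>, 0],
       vector [1 - \<alpha>, \<alpha>, 1 - \<alpha>, \<beta> * (1 - \<alpha>) / (1 - \<beta>)],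
       vector [(1 - \<alpha>) * \<beta> / \<alpha>, \<beta>, 1 - \<beta>, \<beta>],
       vector [0, 1 - \<beta>, 0, 1 - \<beta>]]"
    and "v = vector [\<gamma> * \<alpha>, \<gamma> * (1 - \<alpha>), (1 - \<gamma>) * \<beta>, (1 - \<gamma>) * (1 - \<beta>)]"
    and "n \<ge> 1"
  shows "prob_space.expectation P (\<lambda>\<omega>. real (num_subseqs (map (\<lambda>i. s i \<omega>) [1..<Suc n]))) =
         (vector [1, 1, 1, 1] :: real^4) \<bullet> ((\<Sum>i = 0..n - 1. mat_power M i) *v v)"
proof -
  let ?q = "\<lambda>a b::nat. if a = 1 then if b = 1 then \<alpha> else 1 - \<alpha> else if b = 1 then \<beta> else 1 - \<beta>"
  let ?Pr = "\<lambda>i a. \<P>(\<omega> in P. s i \<omega> = a)"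
  interpret prob_space P using assms(7) by (simp add: markov_chain_def)
  have meas: "s i \<in> measurable P (count_space {0, 1})" for i
    using assms(7) by (simp add: markov_chain_def)
  have range: "s i \<omega> = 0 \<or> s i \<omega> = 1" if "\<omega> \<in> space P" for i \<omega>
    using measurable_space[OF meas that, of i] by simp
  have ev: "{\<omega> \<in> space P. s i \<omega> = a} \<in> events" for i a
    using assms(7) by (rule markov_chain_event)
  have to_1: "\<P>(\<omega> in P. s (Suc i) \<omega> = 1 \<and> s i \<omega> = a) = ?q a 1 * ?Pr i a" if a: "a \<in> {0, 1}" for i a
  proof (cases "?Pr i a = 0")
    case True
    have "\<P>(\<omega> in P. s (Suc i) \<omega> = 1 \<and> s i \<omega> = a) \<le> ?Pr i a"
      by (rule finite_measure_mono) (auto simp: ev)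
    with True show ?thesis by (simp add: measure_le_0_iff)
  next
    case False
    then have "?Pr i a > 0" by (simp add: zero_less_measure_iff)
    then show ?thesis
      using a assms(9)[of "Suc i"] assms(10)[of "Suc i"] by (auto simp: cond_prob_def field_simps)
  qed
  have to_0: "\<P>(\<omega> in P. s (Suc i) \<omega> = 0 \<and> s i \<omega> = a) =
      ?Pr i a - \<P>(\<omega> in P. s (Suc i) \<omega> = 1 \<and> s i \<omega> = a)" for i a
  proof -
    have "{\<omega> \<in> space P. s (Suc i) \<omega> = 0 \<and> s i \<omega> = a}
        = {\<omega> \<in> space P. s i \<omega> = a} - {\<omega> \<in> space P. s (Suc i) \<omega> = 1 \<and> s i \<omega> = a}"
      using range by auto
    then show ?thesis
      using ev by (auto intro!: finite_measure_Diff sets.sets_Collect_conj)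
  qed
  interpret binary_chain P s ?q
  proof
    fix i and x y :: nat assume "x \<in> {0, 1}" "y \<in> {0, 1}"
    then show "\<P>(\<omega> in P. s (Suc i) \<omega> = y \<and> s i \<omega> = x) = ?q x y * ?Pr i x"
      using to_1[of x i] to_0[of i x] by (auto simp: algebra_simps)
  qed (use assms(7) in auto)
  have Pr0: "?Pr 0 0 = 1 - \<gamma>"
  proof -
    have "{\<omega> \<in> space P. s 0 \<omega> = 0} = space P - {\<omega> \<in> space P. s 0 \<omega> = 1}"
      using range by auto
    then show ?thesis using prob_compl[OF ev[of 0 1]] assms(8) by simp
  qed
  \<comment> \<open>the expected number of subsequences created at time \<open>n + 1\<close>, split by the states at times \<open>n\<close>
    and \<open>n + 1\<close>\<close>
  define w where "w n = (vector [\<alpha> * ending_weight n 1 0, (1 - \<alpha>) * ending_weight n 1 1,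
    \<beta> * ending_weight n 0 0, (1 - \<beta>) * ending_weight n 0 1] :: real^4)" for n
  have "w 0 = v"
    by (simp add: w_def ending_weight_0 Pr0 assms(8,12) mult.commute del: One_nat_def)
  have step:
    "ending_weight (Suc k) 1 0 = \<beta> * ending_weight k 0 0 + \<alpha> * ending_weight k 1 0"
    "ending_weight (Suc k) 0 1 = (1 - \<beta>) * ending_weight k 0 1 + (1 - \<alpha>) * ending_weight k 1 1"
    "ending_weight (Suc k) 1 1 = \<beta> * (ending_weight k 0 0 + ending_weight k 0 1)
      + \<alpha> * (ending_weight k 1 0 + ending_weight k 1 1)"
    "ending_weight (Suc k) 0 0 = (1 - \<beta>) * (ending_weight k 0 0 + ending_weight k 0 1)
      + (1 - \<alpha>) * (ending_weight k 1 0 + ending_weight k 1 1)" for k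
    using ending_weight_Suc_other[of 1 0 k] ending_weight_Suc_other[of 0 1 k]
      ending_weight_Suc_same[of 1 k] ending_weight_Suc_same[of 0 k] by simp_all
  have "M *v w k = w (Suc k)" for k
  proof -
    have "\<alpha> \<noteq> 0" "1 - \<beta> \<noteq> 0" using assms(1,4) by auto
    \<comment> \<open>the only entries of \<open>M\<close> with quotients meet a component of \<open>w\<close> that cancels the denominator\<close>
    then have "(1 - \<alpha>) * \<beta> / \<alpha> * (\<alpha> * x) = (1 - \<alpha>) * \<beta> * x"
      "\<beta> * (1 - \<alpha>) / (1 - \<beta>) * ((1 - \<beta>) * x) = \<beta> * (1 - \<alpha>) * x" for x
      by simp_all
    then show ?thesis
      unfolding assms(11) w_def vec_eq_iff forall_4 matrix_vector_mult_def sum_4 step vec_lambda_beta vector_4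
      by (simp only:) (simp add: algebra_simps del: One_nat_def)
  qed
  then have w: "mat_power M k *v v = w k" for k
    by (induction k) (simp_all add: \<open>w 0 = v\<close> flip: matrix_vector_mul_assoc)
  let ?E = "\<lambda>k. expectation (\<lambda>\<omega>. real (num_subseqs (tl (hist k \<omega>))))"
  have increment: "?E (Suc k) = ?E k + (vector [1, 1, 1, 1] :: real^4) \<bullet> w k" for k
    by (simp add: expectation_num_subseqs w_def inner_vec_def sum_4 step algebra_simps del: One_nat_def)
  have "?E 0 = 0" by (simp add: expectation_num_subseqs ending_weight_0 Pr0 assms(8) del: One_nat_def)
  then have "?E k = (\<Sum>i<k. (vector [1, 1, 1, 1] :: real^4) \<bullet> w i)" for k
    by (induction k) (simp_all only: increment add_0_left sum.lessThan_Suc lessThan_0 sum.empty)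
  then have "?E n = (vector [1, 1, 1, 1] :: real^4) \<bullet> ((\<Sum>i = 0..n - 1. mat_power M i) *v v)"
    using assms(13)
    by (cases n) (simp_all add: sum_matrix_vector_mult w inner_sum_right lessThan_Suc_atMost atLeast0AtMost
          del: sum.lessThan_Suc)
  moreover have "tl (hist n \<omega>) = map (\<lambda>i. s i \<omega>) [1..<Suc n]" for \<omega>
    unfolding hist_def by (simp add: upt_conv_Cons del: upt_Suc)
  ultimately show ?thesis by simp
qed

end
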